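(* Let $\mathcal H=(V,\mathcal E)$ be a hypergraph. There exists a set $\mathcal S(\mathcal H)$ of binary strings (over the alphabet $\{0,1\}$), computable in time polynomial in the size of $\mathcal H$, together with a bijection between the collection of maximal independent sets of $\mathcal H$ and the set $\mathrm{MCS}(\mathcal S(\mathcal H))\setminus\{w\}$, where $w=(01)^{|V|-1}$ is the string consisting of $|V|-1$ repetitions of the string $01$ and $\mathrm{MCS}(\mathcal S(\mathcal H))$ denotes the set of maximal common subsequences of $\mathcal S(\mathcal H)$.
   Context: A hypergraph is a pair $\mathcal H=(V,\mathcal E)$ with $V$ a finite set and $\mathcal E$ a set of subsets of $V$ (hyperedges). A set $U\subseteq V$ is independent if no hyperedge $E\in\mathcal E$ satisfies $E\subseteq U$; it is a maximal independent set if no proper superset of $U$ is independent. A string $Y$ is a subsequence of a string $X$ if $Y$ is obtained from $X$ by deleting zero or more characters. For a finite set $\mathcal S$ of strings, a common subsequence is a string that is a subsequence of every string in $\mathcal S$, and a maximal common subsequence is a common subsequence $X$ such that no other common subsequence contains $X$ as a subsequence. For a string $X$ and integer $t$, $X^t$ denotes $X$ repeated $t$ times. *)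

theory Defs
  imports "HOL-Library.Sublist" "HOL-Computational_Algebra.Polynomial"
begin

type_synonym 'a hypergraph = "'a set \<times> 'a set set"

fun hypergraph :: "'a hypergraph \<Rightarrow> bool" where
  "hypergraph (V, E) \<longleftrightarrow> finite V \<and> E \<subseteq> Pow V"

fun independent_set :: "'a hypergraph \<Rightarrow> 'a set \<Rightarrow> bool" where
  "independent_set (V, E) U \<longleftrightarrow> U \<subseteq> V \<and> \<not> (\<exists>e\<in>E. e \<subseteq> U)"

definition maximal_independent_set :: "'a hypergraph \<Rightarrow> 'a set \<Rightarrow> bool" where
  "maximal_independent_set H U \<longleftrightarrow>
     independent_set H U \<and> \<not> (\<exists>W. U \<subset> W \<and> independent_set H W)"

definition common_subsequence :: "'c list set \<Rightarrow> 'c list \<Rightarrow> bool" where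
  "common_subsequence S X \<longleftrightarrow> (\<forall>Y\<in>S. subseq X Y)"

definition MCS :: "'c list set \<Rightarrow> 'c list set" where
  "MCS S = {X. common_subsequence S X \<and>
               \<not> (\<exists>Z. common_subsequence S Z \<and> Z \<noteq> X \<and> subseq X Z)}"

text \<open>Binary strings are Boolean lists, with \<^const>\<open>False\<close> for the character 0 and
  \<^const>\<open>True\<close> for the character 1.\<close>

text \<open>Exponents are natural numbers, so for the hypergraphs without vertices the exponent
  \<open>|V| - 1\<close> is read as 0 and the power is the empty string.\<close>

definition string_power :: "'c list \<Rightarrow> nat \<Rightarrow> 'c list" where
  "string_power X t = concat (replicate t X)"

text \<open>
  The machine model is that of structured programs operating on finitely many stacks over a fixed
  finite alphabet, every elementary operation and every test costing one time unit.  It is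
  equivalent, up to a constant factor in the running time, to multitape Turing machines: a tape is
  a pair of stacks (the parts to the left and to the right of the head), and conversely a stack is
  a tape whose head stays at the top.  A program mentions only finitely many of the stacks, which
  are indexed by natural numbers.
\<close>

datatype symbol = Bit bool | Stop

type_synonym stacks = "nat \<Rightarrow> symbol list"

fun top_of :: "symbol list \<Rightarrow> symbol option" where
  "top_of [] = None"
| "top_of (a # _) = Some a"

text \<open>The set \<open>T\<close> in a test is the set of tops for which the test succeeds; \<^const>\<open>None\<close> stands
  for the empty stack.\<close>

datatype prog =
    Skip
  | Push nat symbol
  | Pop nat
  | Seq prog prog
  | IfTop nat "symbol option set" prog prog
  | WhileTop nat "symbol option set" prog

text \<open>\<open>exec p s t s'\<close>: started in \<open>s\<close>, the program \<open>p\<close> halts in \<open>s'\<close> after exactly \<open>t\<close> time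
  units.\<close>

inductive exec :: "prog \<Rightarrow> stacks \<Rightarrow> nat \<Rightarrow> stacks \<Rightarrow> bool" where
  exec_Skip: "exec Skip s 1 s"
| exec_Push: "exec (Push r a) s 1 (s(r := a # s r))"
| exec_Pop: "exec (Pop r) s 1 (s(r := tl (s r)))"
| exec_Seq: "exec p s t s' \<Longrightarrow> exec p' s' t' s'' \<Longrightarrow> exec (Seq p p') s (t + t') s''"
| exec_If_True: "top_of (s r) \<in> T \<Longrightarrow> exec p s t s' \<Longrightarrow> exec (IfTop r T p p') s (1 + t) s'"
| exec_If_False: "top_of (s r) \<notin> T \<Longrightarrow> exec p' s t s' \<Longrightarrow> exec (IfTop r T p p') s (1 + t) s'"
| exec_While_False: "top_of (s r) \<notin> T \<Longrightarrow> exec (WhileTop r T p) s 1 s"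
| exec_While_True: "top_of (s r) \<in> T \<Longrightarrow> exec p s t s' \<Longrightarrow> exec (WhileTop r T p) s' t' s'' \<Longrightarrow>
    exec (WhileTop r T p) s (1 + t + t') s''"

inductive_cases exec_SkipE: "exec Skip s t s'"
inductive_cases exec_PushE: "exec (Push r a) s t s'"
inductive_cases exec_PopE: "exec (Pop r) s t s'"
inductive_cases exec_SeqE: "exec (Seq p p') s t s'"
inductive_cases exec_IfTopE: "exec (IfTop r T p p') s t s'"
inductive_cases exec_WhileTopE: "exec (WhileTop r T p) s t s'"

lemma exec_deterministic:
  "exec p s t s' \<Longrightarrow> exec p s u s'' \<Longrightarrow> t = u \<and> s' = s''"
proof (induction arbitrary: u s'' rule: exec.induct)
  case exec_Skip
  then show ?case by (auto elim: exec_SkipE)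
next
  case exec_Push
  then show ?case by (auto elim: exec_PushE)
next
  case exec_Pop
  then show ?case by (auto elim: exec_PopE)
next
  case exec_Seq
  from exec_Seq.prems show ?case by (rule exec_SeqE) (use exec_Seq.IH in blast)
next
  case exec_If_True
  from exec_If_True.prems show ?case
    by (rule exec_IfTopE) (use exec_If_True.IH exec_If_True.hyps in fastforce)+
next
  case exec_If_False
  from exec_If_False.prems show ?case
    by (rule exec_IfTopE) (use exec_If_False.IH exec_If_False.hyps in fastforce)+
next
  case exec_While_False
  from exec_While_False.prems show ?case
    by (rule exec_WhileTopE) (use exec_While_False.hyps in fastforce)+
next
  case exec_While_True
  from exec_While_True.prems show ?case
    by (rule exec_WhileTopE) (use exec_While_True.IH exec_While_True.hyps in fastforce)+
qed

text \<open>Input and output are on stack 0, the first symbol on top; all other stacks are empty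
  initially.\<close>

definition initial_stacks :: "symbol list \<Rightarrow> stacks" where
  "initial_stacks x = (\<lambda>_. [])(0 := x)"

text \<open>Objects are presented to programs via relations saying which symbol strings are
  representations of an object.  The function \<open>f\<close> only matters on objects that have a
  representation, and it must be computed correctly from every one of them.\<close>

definition poly_time_computable ::
  "('a \<Rightarrow> symbol list \<Rightarrow> bool) \<Rightarrow> ('b \<Rightarrow> symbol list \<Rightarrow> bool) \<Rightarrow> ('a \<Rightarrow> 'b) \<Rightarrow> bool" where
  "poly_time_computable in_repr out_repr f \<longleftrightarrow>
     (\<exists>(p :: prog) (q :: nat poly). \<forall>a x. in_repr a x \<longrightarrow>
        (\<exists>t s. exec p (initial_stacks x) t s \<and> t \<le> poly q (length x) \<and> out_repr (f a) (s 0)))"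

text \<open>A list of binary strings is written down by terminating each of its members with
  \<^const>\<open>Stop\<close>.\<close>

definition encode_strings :: "bool list list \<Rightarrow> symbol list" where
  "encode_strings xss = concat (map (\<lambda>xs. map Bit xs @ [Stop]) xss)"

definition represents_strings :: "bool list set \<Rightarrow> symbol list \<Rightarrow> bool" where
  "represents_strings S x \<longleftrightarrow> (\<exists>xss. distinct xss \<and> set xss = S \<and> x = encode_strings xss)"

text \<open>A hypergraph is given by the number of its vertices in unary, followed by its hyperedges in
  any order, each as its incidence vector.  The linear order on the vertices serves only to fix
  the order of the entries of these vectors.  Such a representation has length
  \<open>(|V| + 1) * (|E| + 1)\<close>.\<close>

definition incidence_vector :: "'a :: linorder set \<Rightarrow> 'a set \<Rightarrow> bool list" where
  "incidence_vector V e = map (\<lambda>v. v \<in> e) (sorted_list_of_set V)"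

fun represents_hypergraph :: "'a :: linorder hypergraph \<Rightarrow> symbol list \<Rightarrow> bool" where
  "represents_hypergraph (V, E) x \<longleftrightarrow> hypergraph (V, E) \<and>
     (\<exists>es. distinct es \<and> set es = E \<and>
        x = encode_strings (replicate (card V) True # map (incidence_vector V) es))"

end

theory Submission
  imports Defs
begin

text \<open>
  Write \<open>n\<close> for the number of vertices.  A vertex set \<open>U\<close> is encoded by the string with \<open>n\<close> ones
  in which the \<open>i\<close>-th one is preceded by a zero iff \<open>v\<^sub>i \<in> U\<close>; these are the subsequences of
  \<open>(01)\<^sup>n\<close> with \<open>n\<close> ones.  The string of a hyperedge \<open>e\<close> is \<open>(01)\<^bsup>n-1\<^esup>\<close> with an additional 1
  inserted in front of the \<open>i\<close>-th block, or at the end if \<open>i = n\<close>, for every \<open>v\<^sub>i \<in> e\<close>.  It is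
  one block short, and a block can be saved only by matching the \<open>i\<close>-th one of the code of \<open>U\<close> with
  an inserted 1, where \<open>v\<^sub>i \<in> e - U\<close>.  A common subsequence whose greedy embedding into \<open>(01)\<^sup>n\<close>
  needs fewer than \<open>n\<close> blocks is a subsequence of \<open>w\<close>; if it needs all of them, adding the ones that
  the greedy embedding leaves out yields the code of an independent set.
\<close>

section \<open>Codes of vertex sets and strings of hyperedges\<close>

definition set_code :: "bool list \<Rightarrow> bool list" where
  "set_code bs = concat (map (\<lambda>b. if b then [False, True] else [True]) bs)"

fun edge_string :: "bool list \<Rightarrow> bool list" where
  "edge_string [] = []"
| "edge_string (b # bs) = (if b then [True] else []) @
     (if bs = [] then [] else [False, True] @ edge_string bs)"

text \<open>For \<open>n = 0\<close> the string \<open>(01)\<^sup>n\<close> would coincide with \<open>w\<close>.\<close>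

definition base_string :: "nat \<Rightarrow> bool list" where
  "base_string n = (if n = 0 then [True] else string_power [False, True] n)"

fun hypergraph_strings :: "'a :: linorder hypergraph \<Rightarrow> bool list set" where
  "hypergraph_strings (V, E) =
     insert (base_string (card V)) ((\<lambda>e. edge_string (incidence_vector V e)) ` E)"

lemma string_power_0 [simp]: "string_power X 0 = []"
  and string_power_Suc [simp]: "string_power X (Suc n) = X @ string_power X n"
  by (simp_all add: string_power_def)

lemma set_code_Nil [simp]: "set_code [] = []"
  and set_code_Cons [simp]:
    "set_code (b # bs) = (if b then [False, True] else [True]) @ set_code bs"
  by (simp_all add: set_code_def)

lemma subseq_set_code_power: "subseq (set_code us) (string_power [False, True] (length us))"
  by (induction us) auto

lemma count_set_code: "count_list (set_code us) True = length us"
  by (induction us) auto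

lemma count_string_power: "count_list (string_power [False, True] n) b = n"
  by (induction n) (cases b; auto)+

lemma count_edge_string: "count_list (edge_string bs) False = length bs - 1"
  by (induction bs) auto

lemma count_list_subseq: "subseq xs ys \<Longrightarrow> count_list xs a \<le> count_list ys a"
  by (induction rule: list_emb.induct) auto

lemma not_subseq_set_code_power:
  "n < length us \<Longrightarrow> \<not> subseq (set_code us) (string_power [False, True] n)"
  using count_list_subseq[of "set_code us" "string_power [False, True] n" True]
  by (auto simp: count_set_code count_string_power)

text \<open>Both codes have equally many ones, so an embedding matches these in order, and a 0 on
  the left needs a 0 in the same gap on the right.\<close>

lemma subseq_set_code_iff:
  "length us = length vs \<Longrightarrow> subseq (set_code us) (set_code vs) \<longleftrightarrow> list_all2 (\<longrightarrow>) us vs"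
proof (induction us vs rule: list_induct2)
  case (Cons u us v vs)
  \<comment> \<open>Excludes \<open>u\<close> without \<open>v\<close>: the leading 1 on the right
    cannot be matched, and the rest is one 1 short.\<close>
  have "\<not> subseq (False # True # set_code us) (set_code vs)"
    using count_list_subseq[of "False # True # set_code us" "set_code vs" True] Cons.hyps
    by (auto simp: count_set_code)
  with Cons show ?case by auto
qed simp

lemma set_code_inj: "length us = length vs \<Longrightarrow> set_code us = set_code vs \<Longrightarrow> us = vs"
  by (induction us vs rule: list_induct2) (auto split: if_splits)

text \<open>Keeps the output list free of duplicates, as \<open>represents_strings\<close>
  demands.\<close>

lemma edge_string_inj: "length bs = length cs \<Longrightarrow> edge_string bs = edge_string cs \<Longrightarrow> bs = cs"
  by (induction bs cs rule: list_induct2) (auto split: if_splits)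

section \<open>Subsequences of hyperedge strings\<close>

lemma power_subseq_edge_string:
  "subseq (string_power [False, True] (length bs - 1)) (edge_string bs)"
proof (induction bs)
  case (Cons b bs)
  then show ?case by (cases bs) auto
qed simp

text \<open>The extra block makes all of (01)^n available for n = \<open>length bs\<close>, hence
  every code of this length.\<close>

lemma set_code_subseq_block_edge_string:
  "length us = length bs \<Longrightarrow> us \<noteq> [] \<Longrightarrow> subseq (set_code us) (False # True # edge_string bs)"
proof (induction us bs rule: list_induct2)
  case (Cons u us b bs)
  then show ?case by (cases us; cases bs) (auto dest: list_emb_append2[of _ _ _ "[False, True]"])
qed simp

text \<open>Up to the first position of \<open>bs\<close> missing from \<open>us\<close>, each
  position uses its own block. There the inserted 1 is used instead, which saves a block for the
  remaining code.\<close>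

lemma set_code_subseq_edge_string:
  "length us = length bs \<Longrightarrow> \<not> list_all2 (\<longrightarrow>) bs us \<Longrightarrow> subseq (set_code us) (edge_string bs)"
proof (induction us bs rule: list_induct2)
  case (Cons u us b bs)
  show ?case
  proof (cases "b \<and> \<not> u")
    case True
    then show ?thesis
      using Cons.hyps set_code_subseq_block_edge_string[of us bs] by (cases "us = []") auto
  next
    case False
    with Cons have "subseq (set_code us) (edge_string bs)" by auto
    \<comment> \<open>The missing position lies in the tail, so the current position is not the last
      one and has a block.\<close>
    moreover from False Cons.hyps Cons.prems have "bs \<noteq> []" by auto
    ultimately show ?thesis using False by auto
  qed
qed simp

text \<open>\<open>us\<close> records the blocks whose 0 is used by the greedy embedding of
  \<open>X\<close>. Where \<open>us\<close> holds, the unmatched rest of \<open>X\<close> begins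
  with 0, so a 1 inserted there is useless. If all inserted ones were such, \<open>X\<close> would
  fit into \<open>n\<close> blocks.\<close>

lemma greedy_code:
  assumes "subseq X (string_power [False, True] (Suc n))"
    and "\<not> subseq X (string_power [False, True] n)"
  shows "\<exists>us. length us = Suc n \<and> subseq X (set_code us) \<and>
    (\<forall>bs. length bs = Suc n \<longrightarrow> subseq X (edge_string bs) \<longrightarrow> \<not> list_all2 (\<longrightarrow>) bs us)"
  using assms
proof (induction n arbitrary: X)
  case 0
  from 0 consider "X = [False]" | "X = [True]" | "X = [False, True]"
    by (cases X rule: remdups_adj.cases) (auto split: if_splits)
  \<comment> \<open>For a single position the edge string is empty or just 1; the witness bit says
    whether \<open>X\<close> begins with 0.\<close>
  then show ?case
    by cases (rule exI[of _ "[X = [False] \<or> X = [False, True]]"],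
      auto simp: length_Suc_conv split: if_splits)+
next
  case (Suc n)
  \<comment> \<open>\<open>Y\<close> is what the first block leaves of \<open>X\<close>, and
    \<open>u\<close> says whether the 0 of that block is used.\<close>
  have step: ?case
    if Y: "subseq Y (string_power [False, True] (Suc n))"
      "\<not> subseq Y (string_power [False, True] n)"
      and code: "\<And>us. subseq Y (set_code us) \<Longrightarrow> subseq X (set_code (u # us))"
      and edge: "\<And>b bs. bs \<noteq> [] \<Longrightarrow> (b \<longrightarrow> u) \<Longrightarrow> subseq X (edge_string (b # bs)) \<Longrightarrow>
        subseq Y (edge_string bs)" for Y u
  proof -
    from Suc.IH[OF Y] obtain us where us: "length us = Suc n" "subseq Y (set_code us)"
      "\<And>bs. length bs = Suc n \<Longrightarrow> subseq Y (edge_string bs) \<Longrightarrow> \<not> list_all2 (\<longrightarrow>) bs us" by auto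
    show ?thesis
    proof (intro exI[of _ "u # us"] conjI allI impI notI)
      fix bs assume "length bs = Suc (Suc n)" "subseq X (edge_string bs)"
        "list_all2 (\<longrightarrow>) bs (u # us)"
      moreover from this obtain b bs' where "bs = b # bs'" by (cases bs) auto
      ultimately have "length bs' = Suc n" "subseq X (edge_string (b # bs'))" "b \<longrightarrow> u"
        "list_all2 (\<longrightarrow>) bs' us" by auto
      with us(3)[of bs'] edge[of bs' b] show False by fastforce
    qed (use us code in auto)
  qed
  show ?case
  proof (cases X)
    case Nil
    with Suc.prems show ?thesis by simp
  next
    case (Cons a Y)
    show ?thesis
    proof (cases a)
      case True
      with Suc.prems Cons show ?thesis
        by (intro step[of Y False]) (auto split: if_splits)
    next
      case a: False
      show ?thesis
      proof (cases Y)
        case Nil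
        with Suc.prems Cons a show ?thesis by simp
      next
        case Y: (Cons c Z)
        show ?thesis
        proof (cases c)
          case True
          with Suc.prems Cons a Y show ?thesis
            by (intro step[of Z True]) (auto split: if_splits)
        next
          case False
          \<comment> \<open>After 00 the greedy embedding skips the 1 of the first block; the code
            supplies it.\<close>
          with Suc.prems Cons a Y show ?thesis
            by (intro step[of Y True]) (auto split: if_splits)
        qed
      qed
    qed
  qed
qed

section \<open>Incidence vectors\<close>

lemma length_incidence_vector [simp]: "length (incidence_vector V e) = card V"
  by (simp add: incidence_vector_def)

lemma list_all2_incidence_vector_iff:
  "finite V \<Longrightarrow> A \<subseteq> V \<Longrightarrow>
    list_all2 (\<longrightarrow>) (incidence_vector V A) (incidence_vector V B) \<longleftrightarrow> A \<subseteq> B"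
  by (auto simp: incidence_vector_def list_all2_map1 list_all2_map2 list_all2_same)

lemma incidence_vector_inj_on: "finite V \<Longrightarrow> inj_on (incidence_vector V) (Pow V)"
  by (auto simp: inj_on_def incidence_vector_def)

lemma incidence_vector_surj:
  assumes "finite V" "length us = card V"
  obtains U where "U \<subseteq> V" "us = incidence_vector V U"
proof
  let ?l = "sorted_list_of_set V"
  show "{?l ! i |i. i < card V \<and> us ! i} \<subseteq> V"
    using assms nth_mem[of _ ?l] by auto
  show "us = incidence_vector V {?l ! i |i. i < card V \<and> us ! i}"
    using assms by (auto simp: incidence_vector_def nth_eq_iff_index_eq intro!: nth_equalityI)
qed

section \<open>The bijection\<close>

lemma common_subsequence_hypergraph_strings_iff:
  "common_subsequence (hypergraph_strings (V, E)) X \<longleftrightarrow> subseq X (base_string (card V)) \<and>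
     (\<forall>e\<in>E. subseq X (edge_string (incidence_vector V e)))"
  by (auto simp: common_subsequence_def)

declare hypergraph_strings.simps [simp del]

text \<open>Below \<open>?w\<close> only \<open>?w\<close> itself can be maximal. Every other common
  subsequence lies below the code of an independent set, and codes are ordered by inclusion of the
  sets.\<close>

lemma bij_betw_set_codes_MCS:
  assumes "hypergraph (V, E)" and "V \<noteq> {}"
  shows "bij_betw (\<lambda>U. set_code (incidence_vector V U)) {U. maximal_independent_set (V, E) U}
    (MCS (hypergraph_strings (V, E)) - {string_power [False, True] (card V - 1)})"
proof -
  let ?c = "\<lambda>U. set_code (incidence_vector V U)"
  let ?w = "string_power [False, True] (card V - 1)"
  let ?common = "common_subsequence (hypergraph_strings (V, E))"
  have fin: "finite V" and E: "\<And>e. e \<in> E \<Longrightarrow> e \<subseteq> V" using assms(1) by auto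
  have n: "card V = Suc (card V - 1)" using assms(2) fin by (simp add: card_gt_0_iff)
  have base: "base_string (card V) = string_power [False, True] (card V)"
    using n by (simp add: base_string_def)
  have mono: "subseq (?c U) (?c W) \<longleftrightarrow> U \<subseteq> W" if "U \<subseteq> V" for U W
    using that fin by (simp add: subseq_set_code_iff list_all2_incidence_vector_iff)
  \<comment> \<open>A code has \<open>card V\<close> ones, \<open>?w\<close> one fewer.\<close>
  have not_w: "\<not> subseq (?c U) ?w" for U
    using n by (intro not_subseq_set_code_power) simp
  \<comment> \<open>\<open>?w\<close> need not be maximal; removing it from the maximal ones covers
    both cases.\<close>
  have common_w: "?common ?w"
    unfolding common_subsequence_hypergraph_strings_iff base
  proof (intro conjI ballI)
    show "subseq ?w (string_power [False, True] (card V))"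
      by (subst (2) n) (simp add: list_emb_Cons)
    show "subseq ?w (edge_string (incidence_vector V e))" for e
      using power_subseq_edge_string[of "incidence_vector V e"] by simp
  qed
  have common_code: "?common (?c U)" if "independent_set (V, E) U" for U
    unfolding common_subsequence_hypergraph_strings_iff base
    using that fin E subseq_set_code_power[of "incidence_vector V U"]
    by (auto simp: list_all2_incidence_vector_iff intro!: set_code_subseq_edge_string)
  have below_code: "\<exists>U. independent_set (V, E) U \<and> subseq X (?c U)"
    if X: "?common X" "\<not> subseq X ?w" for X
  proof -
    have "subseq X (string_power [False, True] (Suc (card V - 1)))"
      using X(1) n base by (simp add: common_subsequence_hypergraph_strings_iff)
    from greedy_code[OF this X(2)] n obtain us where us: "length us = card V" "subseq X (set_code us)"
      "\<And>bs. length bs = card V \<Longrightarrow> subseq X (edge_string bs) \<Longrightarrow> \<not> list_all2 (\<longrightarrow>) bs us"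
      by auto
    obtain U where U: "U \<subseteq> V" "us = incidence_vector V U"
      using incidence_vector_surj[OF fin us(1)] .
    have "\<not> e \<subseteq> U" if "e \<in> E" for e
      using us(3)[of "incidence_vector V e"] that X(1) U(2) E[OF that] fin
      by (auto simp: common_subsequence_hypergraph_strings_iff list_all2_incidence_vector_iff)
    with U us(2) show ?thesis by auto
  qed
  have subset: "U \<subseteq> V" if "independent_set (V, E) U" for U using that by simp
  show ?thesis
  proof (rule bij_betw_imageI)
    show "inj_on ?c {U. maximal_independent_set (V, E) U}"
    proof (rule inj_onI)
      fix U W assume "U \<in> {U. maximal_independent_set (V, E) U}"
        "W \<in> {U. maximal_independent_set (V, E) U}" and eq: "?c U = ?c W"
      then have "U \<in> Pow V" "W \<in> Pow V" by (auto simp: maximal_independent_set_def)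
      moreover from eq have "incidence_vector V U = incidence_vector V W"
        by (rule set_code_inj[rotated]) simp
      ultimately show "U = W" using incidence_vector_inj_on[OF fin] by (auto dest: inj_onD)
    qed
    show "?c ` {U. maximal_independent_set (V, E) U} = MCS (hypergraph_strings (V, E)) - {?w}"
    proof (intro equalityI subsetI)
      fix X assume "X \<in> ?c ` {U. maximal_independent_set (V, E) U}"
      then obtain U where X: "X = ?c U" and U: "independent_set (V, E) U"
        "\<And>W. U \<subset> W \<Longrightarrow> \<not> independent_set (V, E) W"
        by (auto simp: maximal_independent_set_def)
      have "Z = X" if Z: "?common Z" "subseq X Z" for Z
      proof -
        \<comment> \<open>\<open>Z\<close> lies above a code, so it is not below \<open>?w\<close>
          and is squeezed between the codes of \<open>U\<close> and some \<open>W\<close>.\<close>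
        have "\<not> subseq Z ?w" using not_w[of U] Z(2) X subseq_order.trans by blast
        with below_code[OF Z(1)] obtain W where W: "independent_set (V, E) W" "subseq Z (?c W)"
          by blast
        then have "U \<subseteq> W" using mono[OF subset[OF U(1)]] Z(2) X subseq_order.trans by blast
        with U(2) W(1) have "U = W" by blast
        with W(2) Z(2) X show ?thesis by (auto intro: subseq_order.antisym)
      qed
      moreover have "X \<noteq> ?w" using not_w[of U] X by auto
      ultimately show "X \<in> MCS (hypergraph_strings (V, E)) - {?w}"
        using common_code[OF U(1)] X unfolding MCS_def by blast
    next
      fix X assume "X \<in> MCS (hypergraph_strings (V, E)) - {?w}"
      then have X: "?common X" "X \<noteq> ?w" "\<And>Z. ?common Z \<Longrightarrow> subseq X Z \<Longrightarrow> Z = X"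
        unfolding MCS_def by blast+
      then have "\<not> subseq X ?w" using common_w by blast
      from below_code[OF X(1) this] obtain U where U: "independent_set (V, E) U" "subseq X (?c U)"
        by blast
      with X(3) common_code have eq: "X = ?c U" by metis
      have "maximal_independent_set (V, E) U"
        unfolding maximal_independent_set_def
      proof (intro conjI notI, fact, elim exE conjE)
        fix W assume W: "U \<subset> W" "independent_set (V, E) W"
        then have "subseq (?c U) (?c W)" using mono[OF subset[OF U(1)]] by auto
        with X(3)[OF common_code[OF W(2)]] eq have "?c W = ?c U" by simp
        with mono[OF subset[OF W(2)], of U] W(1) show False by auto
      qed
      with eq show "X \<in> ?c ` {U. maximal_independent_set (V, E) U}" by blast
    qed
  qed
qed

text \<open>Here \<open>w\<close> is empty. Without hyperedges the empty set corresponds to the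
  string 1; with the empty hyperedge no set is independent and only the empty string is
  common.\<close>

lemma MCS_hypergraph_strings_no_vertices:
  assumes "hypergraph ({}, E)"
  shows "\<exists>f. bij_betw f {U. maximal_independent_set ({}, E) U}
    (MCS (hypergraph_strings ({} :: 'a :: linorder set, E)) - {[]})"
proof -
  from assms consider "E = {}" | "E = {{}}" by (auto simp: subset_singleton_iff)
  then show ?thesis
  proof cases
    case 1
    have "MCS {[True]} = {[True]}" by (auto simp: MCS_def common_subsequence_def)
    then have "MCS (hypergraph_strings ({} :: 'a set, E)) - {[]} = {[True]}"
      using 1 by (simp add: base_string_def hypergraph_strings.simps)
    moreover have "{U. maximal_independent_set ({} :: 'a set, E) U} = {{}}"
      using 1 by (auto simp: maximal_independent_set_def)
    ultimately show ?thesis by (auto simp: bij_betw_def)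
  next
    case 2
    have "MCS (hypergraph_strings ({} :: 'a set, E)) - {[]} = {}"
      using 2 by (auto simp: MCS_def common_subsequence_hypergraph_strings_iff incidence_vector_def)
    moreover have "{U. maximal_independent_set ({} :: 'a set, E) U} = {}"
      using 2 by (auto simp: maximal_independent_set_def)
    ultimately show ?thesis by (simp add: bij_betw_def)
  qed
qed

subsection \<open>Computing the strings in linear time\<close>

text \<open>Upper bounds instead of exact times let branches of different length share one
  bound.\<close>

definition runs :: "prog \<Rightarrow> stacks \<Rightarrow> nat \<Rightarrow> stacks \<Rightarrow> bool" where
  "runs p s k s' \<longleftrightarrow> (\<exists>t\<le>k. exec p s t s')"

lemma runs_weaken: "runs p s k s' \<Longrightarrow> k \<le> m \<Longrightarrow> runs p s m s'"
  unfolding runs_def using le_trans by blast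

lemma runs_Seq: "runs p s k s' \<Longrightarrow> runs p' s' k' s'' \<Longrightarrow> runs (Seq p p') s (k + k') s''"
  unfolding runs_def by (blast intro: exec_Seq add_mono)

lemma runs_While_False: "top_of (s r) \<notin> T \<Longrightarrow> runs (WhileTop r T p) s 1 s"
  unfolding runs_def by (blast intro: exec_While_False order_refl)

lemma runs_While_True:
  "top_of (s r) \<in> T \<Longrightarrow> runs p s k s' \<Longrightarrow> runs (WhileTop r T p) s' k' s'' \<Longrightarrow>
    runs (WhileTop r T p) s (1 + k + k') s''"
  unfolding runs_def by (blast intro: exec_While_True add_mono order_refl)

text \<open>Loop-free bodies can be evaluated by \<open>effect\<close>, which leaves inductions only
  for the loops.\<close>

fun loop_free :: "prog \<Rightarrow> bool" where
  "loop_free (Seq p p') \<longleftrightarrow> loop_free p \<and> loop_free p'"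
| "loop_free (IfTop r T p p') \<longleftrightarrow> loop_free p \<and> loop_free p'"
| "loop_free (WhileTop r T p) \<longleftrightarrow> False"
| "loop_free _ \<longleftrightarrow> True"

text \<open>The values of the following two functions on loops are irrelevant.\<close>

fun cost :: "prog \<Rightarrow> nat" where
  "cost (Seq p p') = cost p + cost p'"
| "cost (IfTop r T p p') = 1 + max (cost p) (cost p')"
| "cost _ = 1"

fun effect :: "prog \<Rightarrow> stacks \<Rightarrow> stacks" where
  "effect (Push r a) s = s(r := a # s r)"
| "effect (Pop r) s = s(r := tl (s r))"
| "effect (Seq p p') s = effect p' (effect p s)"
| "effect (IfTop r T p p') s = (if top_of (s r) \<in> T then effect p s else effect p' s)"
| "effect _ s = s"

lemma runs_loop_free: "loop_free p \<Longrightarrow> effect p s = s' \<Longrightarrow> runs p s (cost p) s'"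
proof (induction p arbitrary: s s')
  case (Seq p p')
  then show ?case by (auto intro: runs_Seq)
next
  case (IfTop r T p p')
  show ?case
  proof (cases "top_of (s r) \<in> T")
    case True
    with IfTop obtain t where "exec p s t s'" "t \<le> cost p" by (auto simp: runs_def)
    with True exec_If_True[of s r T p t s' p'] show ?thesis
      unfolding runs_def by (auto intro!: exI[of _ "1 + t"] simp: max.coboundedI1)
  next
    case False
    with IfTop obtain t where "exec p' s t s'" "t \<le> cost p'" by (auto simp: runs_def)
    with False exec_If_False[of s r T p' t s' p] show ?thesis
      unfolding runs_def by (auto intro!: exI[of _ "1 + t"] simp: max.coboundedI2)
  qed
qed (use exec.intros in \<open>fastforce simp: runs_def\<close>)+

text \<open>Equations and a separate time bound among the premises let the induction hypothesis
  apply to states that are equal only after simplification.\<close>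

lemma runs_While_loop_free:
  assumes "top_of (s r) \<in> T" "loop_free p" "effect p s = s'"
    and "runs (WhileTop r T p) s' k s''" "s'' = u" "1 + cost p + k \<le> m"
  shows "runs (WhileTop r T p) s m u"
  using runs_While_True[OF assms(1) runs_loop_free[OF assms(2,3)] assms(4)] assms(5,6)
  by (auto intro: runs_weaken)

text \<open>Stack 0 holds input and output, stack 1 the reversed hyperedges, stack 2 the vertex
  count in unary.\<close>

definition three_stacks :: "symbol list \<Rightarrow> symbol list \<Rightarrow> symbol list \<Rightarrow> stacks" where
  "three_stacks x y z = (\<lambda>_. [])(0 := x, 1 := y, 2 := z)"

lemma three_stacks_simps [simp]:
  "three_stacks x y z 0 = x"
  "three_stacks x y z (Suc 0) = y"
  "three_stacks x y z 2 = z"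
  "(three_stacks x y z)(0 := u) = three_stacks u y z"
  "(three_stacks x y z)(Suc 0 := u) = three_stacks x u z"
  "(three_stacks x y z)(2 := u) = three_stacks x y u"
  by (auto simp: three_stacks_def)

section \<open>Stack programs of the reduction\<close>

abbreviation bit_tops :: "symbol option set" where
  "bit_tops \<equiv> {Some (Bit False), Some (Bit True)}"

definition split_off_unary :: prog where
  "split_off_unary = WhileTop 0 bit_tops (Seq (Pop 0) (Push 2 (Bit True)))"

lemma runs_split_off_unary:
  "runs split_off_unary (three_stacks (replicate n (Bit True) @ Stop # x) y z) (3 * n + 1)
    (three_stacks (Stop # x) y (replicate n (Bit True) @ z))"
proof (induction n arbitrary: z)
  case 0
  show ?case
    using runs_While_False[of "three_stacks (Stop # x) y z" 0 bit_tops]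
    by (simp add: split_off_unary_def)
next
  case (Suc n)
  show ?case
    unfolding split_off_unary_def
    by (rule runs_While_loop_free[OF _ _ _ Suc.IH[of "Bit True # z", unfolded split_off_unary_def]])
      (auto simp: replicate_app_Cons_same)
qed

text \<open>Reversal lets the output be built by pushing, last hyperedge first. \<open>Push\<close>
  names a fixed symbol, so copying needs a case distinction.\<close>

definition move_reversed :: prog where
  "move_reversed = WhileTop 0 (- {None})
     (Seq (IfTop 0 {Some Stop} (Push 1 Stop)
            (IfTop 0 {Some (Bit True)} (Push 1 (Bit True)) (Push 1 (Bit False))))
          (Pop 0))"

lemma runs_move_reversed:
  "runs move_reversed (three_stacks x y z) (5 * length x + 1) (three_stacks [] (rev x @ y) z)"
proof (induction x arbitrary: y)
  case Nil
  show ?case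
    using runs_While_False[of "three_stacks [] y z" 0 "- {None}"]
    by (simp add: move_reversed_def)
next
  case (Cons a x)
  have "a = Stop \<or> a = Bit True \<or> a = Bit False" by (cases a) auto
  then show ?case
    unfolding move_reversed_def
    by (elim disjE; intro runs_While_loop_free[OF _ _ _
          Cons.IH[of "a # y", unfolded move_reversed_def]]) auto
qed

text \<open>Recursion from the end, matching the order in which \<open>convert_edge\<close> reads
  the bits.\<close>

lemma edge_string_snoc:
  "edge_string (bs @ [b]) =
     edge_string bs @ (if bs = [] then [] else [False, True]) @ (if b then [True] else [])"
  by (induction bs) auto

text \<open>The stacks reverse the hyperedge, so its string is pushed from its end.\<close>

definition convert_edge :: prog where
  "convert_edge = WhileTop 1 bit_tops
     (Seq (IfTop 1 {Some (Bit True)} (Push 0 (Bit True)) Skip)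
          (Seq (Pop 1) (IfTop 1 bit_tops (Seq (Push 0 (Bit True)) (Push 0 (Bit False))) Skip)))"

text \<open>The test after \<open>Pop 1\<close> decides whether a block is due. By the assumption on
  \<open>y\<close> it fails exactly at the end of the vector.\<close>

lemma runs_convert_edge:
  assumes "top_of y \<notin> bit_tops"
  shows "runs convert_edge (three_stacks x (map Bit (rev bs) @ y) z) (8 * length bs + 1)
    (three_stacks (map Bit (edge_string bs) @ x) y z)"
proof (induction bs arbitrary: x rule: rev_induct)
  case Nil
  show ?case
    using runs_While_False[of "three_stacks x y z" 1 bit_tops] assms
    by (simp add: convert_edge_def)
next
  case (snoc b bs)
  let ?x = "map Bit ((if bs = [] then [] else [False, True]) @ (if b then [True] else [])) @ x"
  have top: "top_of (map Bit (rev bs) @ y) \<in> bit_tops \<longleftrightarrow> bs \<noteq> []"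
    using assms by (cases bs rule: rev_cases) auto
  show ?case
    unfolding convert_edge_def
    by (rule runs_While_loop_free[OF _ _ _ snoc[of ?x, unfolded convert_edge_def]])
      (use top in \<open>auto simp: edge_string_snoc\<close>)
qed

lemma encode_strings_simps [simp]:
  "encode_strings [] = []"
  "encode_strings (xs # xss) = map Bit xs @ Stop # encode_strings xss"
  "encode_strings (xss @ yss) = encode_strings xss @ encode_strings yss"
  by (simp_all add: encode_strings_def)

definition convert_edges :: prog where
  "convert_edges = WhileTop 1 {Some Stop} (Seq (Seq (Pop 1) (Push 0 Stop)) convert_edge)"

lemma runs_convert_edges:
  "runs convert_edges (three_stacks x (rev (encode_strings bss)) z)
    (8 * length (encode_strings bss) + 1)
    (three_stacks (encode_strings (map edge_string bss) @ x) [] z)"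
proof (induction bss arbitrary: x rule: rev_induct)
  case Nil
  show ?case
    using runs_While_False[of "three_stacks x [] z" 1 "{Some Stop}"]
    by (simp add: convert_edges_def)
next
  case (snoc bs bss)
  let ?y = "rev (encode_strings bss)"
  \<comment> \<open>Below the current vector is the \<open>Stop\<close> of the preceding hyperedge
    or nothing.\<close>
  have "top_of ?y \<notin> bit_tops" by (cases bss rule: rev_cases) auto
  note edge = runs_convert_edge[OF this, of "Stop # x" bs z]
  have "runs (Seq (Pop 1) (Push 0 Stop)) (three_stacks x (Stop # map Bit (rev bs) @ ?y) z)
      (cost (Seq (Pop 1) (Push 0 Stop))) (three_stacks (Stop # x) (map Bit (rev bs) @ ?y) z)"
    by (rule runs_loop_free) simp_all
  from runs_Seq[OF this edge] have "runs (Seq (Seq (Pop 1) (Push 0 Stop)) convert_edge)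
    (three_stacks x (Stop # map Bit (rev bs) @ ?y) z) (2 + (8 * length bs + 1))
    (three_stacks (map Bit (edge_string bs) @ Stop # x) ?y z)" by simp
  from runs_While_True[OF _ this, of 1 "{Some Stop}", folded convert_edges_def, OF _ snoc]
  show ?case by (auto elim!: runs_weaken simp: rev_map)
qed

definition push_power :: prog where
  "push_power = WhileTop 2 bit_tops (Seq (Pop 2) (Seq (Push 0 (Bit True)) (Push 0 (Bit False))))"

lemma runs_push_power:
  "runs push_power (three_stacks x y (replicate n (Bit True))) (4 * n + 1)
    (three_stacks (map Bit (string_power [False, True] n) @ x) y [])"
proof (induction n arbitrary: x)
  case 0
  show ?case
    using runs_While_False[of "three_stacks x y []" 2 bit_tops] by (simp add: push_power_def)
next
  case (Suc n)
  \<comment> \<open>The loop adds blocks in front of those already written, so the block 01 has to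
    commute with its powers.\<close>
  have eq: "map Bit (string_power [False, True] n) @ Bit False # Bit True # x =
      Bit False # Bit True # map Bit (string_power [False, True] n) @ x"
    by (induction n) auto
  show ?case
    unfolding push_power_def
    by (rule runs_While_loop_free[OF _ _ _ Suc.IH[of "Bit False # Bit True # x",
            unfolded push_power_def]]) (simp_all only: eq, auto)
qed

text \<open>An empty stack 2 means no vertices; then the exceptional string 1 is written and the
  loop does nothing.\<close>

definition push_base_string :: prog where
  "push_base_string =
     Seq (Seq (Push 0 Stop) (IfTop 2 {None} (Push 0 (Bit True)) Skip)) push_power"

lemma runs_push_base_string:
  "runs push_base_string (three_stacks x y (replicate n (Bit True))) (4 * n + 4)
    (three_stacks (map Bit (base_string n) @ Stop # x) y [])"
proof -
  let ?p = "Seq (Push 0 Stop) (IfTop 2 {None} (Push 0 (Bit True)) Skip)"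
  let ?x = "if n = 0 then Bit True # Stop # x else Stop # x"
  have "runs ?p (three_stacks x y (replicate n (Bit True))) (cost ?p)
      (three_stacks ?x y (replicate n (Bit True)))"
    by (rule runs_loop_free) (cases n; simp)+
  from runs_Seq[OF this runs_push_power] show ?thesis
    by (auto elim!: runs_weaken simp: push_base_string_def base_string_def split: if_splits)
qed

definition reduction_program :: prog where
  "reduction_program = Seq split_off_unary
     (Seq (Pop 0) (Seq move_reversed (Seq convert_edges push_base_string)))"

text \<open>The factor 13 is 5 for reversing plus 8 for converting; each unit of the vertex count
  costs only 3 + 4.\<close>

lemma runs_reduction_program:
  "runs reduction_program (initial_stacks (encode_strings (replicate n True # bss)))
    (13 * length (encode_strings (replicate n True # bss)) + 8)
    (three_stacks (encode_strings (base_string n # map edge_string bss)) [] [])"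
proof -
  let ?x = "encode_strings bss"
  have init: "initial_stacks (encode_strings (replicate n True # bss)) =
      three_stacks (replicate n (Bit True) @ Stop # ?x) [] []"
    by (auto simp: initial_stacks_def three_stacks_def)
  have pop: "runs (Pop 0) (three_stacks (Stop # x) y z) 1 (three_stacks x y z)" for x y z
    using runs_loop_free[of "Pop 0" "three_stacks (Stop # x) y z"] by simp
  have move: "runs move_reversed (three_stacks ?x [] z) (5 * length ?x + 1)
      (three_stacks [] (rev ?x) z)" for z
    using runs_move_reversed[of ?x "[]" z] by simp
  have split: "runs split_off_unary (three_stacks (replicate n (Bit True) @ Stop # ?x) [] [])
      (3 * n + 1) (three_stacks (Stop # ?x) [] (replicate n (Bit True)))"
    using runs_split_off_unary[of n ?x "[]" "[]"] by simp
  from runs_Seq[OF split runs_Seq[OF pop runs_Seq[OF move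
        runs_Seq[OF runs_convert_edges runs_push_base_string]]]]
  show ?thesis
    unfolding reduction_program_def init by (auto elim!: runs_weaken)
qed

text \<open>For a nonempty vector the numbers of zeros differ by one; for the empty vector the
  strings are 1 and empty.\<close>

lemma base_string_neq_edge_string: "base_string (length bs) \<noteq> edge_string bs"
proof
  assume eq: "base_string (length bs) = edge_string bs"
  then have "length bs > 0" by (auto simp: base_string_def)
  with arg_cong[OF eq, of "\<lambda>u. count_list u False"] show False
    by (simp add: base_string_def count_string_power count_edge_string) (cases bs; simp)
qed

lemma poly_time_computable_hypergraph_strings:
  "poly_time_computable represents_hypergraph represents_strings
    (hypergraph_strings :: 'a :: linorder hypergraph \<Rightarrow> _)"
  unfolding poly_time_computable_def
proof (rule exI[of _ reduction_program], rule exI[of _ "[:8, 13:]"], intro allI impI)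
  fix H :: "'a hypergraph" and x assume H: "represents_hypergraph H x"
  obtain V E where VE: "H = (V, E)" by fastforce
  from H VE obtain es where V: "finite V" "E \<subseteq> Pow V" and es: "distinct es" "set es = E"
    and x: "x = encode_strings (replicate (card V) True # map (incidence_vector V) es)" by auto
  \<comment> \<open>The hyperedges keep their input order, so each representation yields one
    particular listing of the set.\<close>
  let ?out = "base_string (card V) # map edge_string (map (incidence_vector V) es)"
  have "inj_on (\<lambda>e. edge_string (incidence_vector V e)) E"
    using edge_string_inj incidence_vector_inj_on[OF V(1)] V(2)
    by (intro inj_onI) (metis inj_onD length_incidence_vector subsetD)
  moreover have "base_string (card V) \<noteq> edge_string (incidence_vector V e)" for e
    using base_string_neq_edge_string[of "incidence_vector V e"] by simp
  ultimately have "represents_strings (hypergraph_strings H) (encode_strings ?out)"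
    unfolding represents_strings_def using VE es
    by (intro exI[of _ ?out]) (auto simp: hypergraph_strings.simps distinct_map inj_on_def)
  moreover obtain t where "exec reduction_program (initial_stacks x) t
      (three_stacks (encode_strings ?out) [] [])" "t \<le> 13 * length x + 8"
    using runs_reduction_program unfolding x runs_def by blast
  ultimately show "\<exists>t s. exec reduction_program (initial_stacks x) t s \<and>
      t \<le> poly [:8, 13:] (length x) \<and> represents_strings (hypergraph_strings H) (s 0)"
    by (intro exI[of _ t] exI[of _ "three_stacks (encode_strings ?out) [] []"])
      (simp add: algebra_simps)
qed

theorem theorem2:
  "\<exists>S :: 'a :: linorder hypergraph \<Rightarrow> bool list set.
     poly_time_computable represents_hypergraph represents_strings S \<and>
     (\<forall>V E. hypergraph (V, E) \<longrightarrow>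
        (\<exists>f. bij_betw f {U. maximal_independent_set (V, E) U}
               (MCS (S (V, E)) - {string_power [False, True] (card V - 1)})))"
proof (intro exI[of _ hypergraph_strings] conjI allI impI)
  show "poly_time_computable represents_hypergraph represents_strings
      (hypergraph_strings :: 'a hypergraph \<Rightarrow> _)"
    by (rule poly_time_computable_hypergraph_strings)
next
  fix V :: "'a set" and E assume H: "hypergraph (V, E)"
  show "\<exists>f. bij_betw f {U. maximal_independent_set (V, E) U}
      (MCS (hypergraph_strings (V, E)) - {string_power [False, True] (card V - 1)})"
  \<comment> \<open>Without vertices \<open>card V - 1\<close> is 0 by truncated subtraction, so
    \<open>w\<close> is empty.\<close>
  proof (cases "V = {}")
    case True
    with MCS_hypergraph_strings_no_vertices[of E] H show ?thesis by simp
  next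
    case False
    from bij_betw_set_codes_MCS[OF H this] show ?thesis by blast
  qed
qed

end
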